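(* Let $B\subseteq\mathbb{N}$ be such that for every $A>0$ one has $B(x)\ll_A x\log^{-A}x$ (for $x\ge 2$). Then for all $C>0$ and for almost all positive integers $q\le x^{1/2}$ we have $$B_{h,q}(x)\ll \frac{x}{q\log^{C}x},$$ uniformly in all residues $h$ mod $q$. That is, for every $C>0$ there is a constant $K>0$ (depending only on $B$ and $C$) such that $$\#\Bigl\{q\le x^{1/2} : B_{h,q}(x)>K\,\frac{x}{q\log^{C}x}\ \text{ for at least one residue } h \text{ mod } q\Bigr\}=o(x^{1/2})\qquad (x\to\infty).$$
   Context: For $B\subseteq\mathbb{N}$ (positive integers), real $x$, a positive integer $q$ and a residue class $h$ mod $q$, put $B(x):=\#\{n\le x : n\in B\}$ and $B_{h,q}(x):=\#\{n\le x : n\in B,\ n\equiv h \pmod q\}$. Here $\log^{A}x=(\log x)^{A}$. "For almost all $q\le x^{1/2}$" means that the number of positive integers $q\le x^{1/2}$ for which the assertion fails is $o(x^{1/2})$ as $x\to\infty$. *)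

theory Defs
  imports Complex_Main "HOL-Library.Landau_Symbols" "HOL-Number_Theory.Cong"
begin

definition count_upto :: "nat set \<Rightarrow> real \<Rightarrow> nat" where
  "count_upto B x = card {n \<in> B. real n \<le> x}"

definition count_ap :: "nat set \<Rightarrow> int \<Rightarrow> nat \<Rightarrow> real \<Rightarrow> nat" where
  "count_ap B h q x = card {n \<in> B. real n \<le> x \<and> [int n = h] (mod int q)}"

end

(* Let N be the number of exceptional q, and for each of them let S q be a residue class of B up to x
   with more than x / (q (ln x)^C) elements. The sets S q lie in B, which is sparse, so by
   Cauchy-Schwarz their pairwise intersections are large on average:
     (N sqrt x / (ln x)^C)^2 <= B(x) * sum_{q,r} card (S q \<inter> S r).
   But S q \<inter> S r lies in one residue class modulo lcm q r <= x, so it has at most 2 x gcd(q,r) / (q r)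
   elements, and summing this over q, r <= sqrt x gives O(x (ln x)^3). As B(x) saves an arbitrary
   power of ln x, this forces N = O(sqrt x / ln x), even with K = 1. *)
theory Submission
  imports Defs "HOL-Analysis.Harmonic_Numbers" "HOL-Analysis.Convex" "HOL-Real_Asymp.Real_Asymp"
begin

text \<open>Elements of one residue class modulo \<open>l\<close> are determined by their quotients
  by \<open>l\<close>, and these quotients lie between 0 and \<open>x / l\<close>. The summand 1
  accounts for the quotient 0.\<close>

lemma card_residue_class_le:
  fixes A :: "nat set" and x :: real
  assumes bound: "\<And>n. n \<in> A \<Longrightarrow> real n \<le> x"
    and cong: "\<And>m n. m \<in> A \<Longrightarrow> n \<in> A \<Longrightarrow> [m = n] (mod l)"
    and "l > 0" "x \<ge> 0"
  shows "real (card A) \<le> x / real l + 1"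
proof -
  have inj: "inj_on (\<lambda>n. n div l) A"
  proof (rule inj_onI)
    fix m n assume "m \<in> A" "n \<in> A" "m div l = n div l"
    moreover from this have "m mod l = n mod l"
      using cong[of m n] by (simp add: unique_euclidean_semiring_class.cong_def)
    ultimately show "m = n"
      by (metis div_mult_mod_eq)
  qed
  have "(\<lambda>n. n div l) ` A \<subseteq> {..nat \<lfloor>x / real l\<rfloor>}"
  proof
    fix k assume "k \<in> (\<lambda>n. n div l) ` A"
    then obtain n where n: "n \<in> A" "k = n div l" by blast
    have "real k \<le> real n / real l"
      unfolding n(2) by (rule of_nat_div_le_of_nat)
    also have "\<dots> \<le> x / real l"
      using bound[OF n(1)] by (simp add: divide_right_mono)
    finally show "k \<in> {..nat \<lfloor>x / real l\<rfloor>}"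
      by (simp add: le_nat_floor)
  qed
  then have "card A \<le> card {..nat \<lfloor>x / real l\<rfloor>}"
    using card_mono[of "{..nat \<lfloor>x / real l\<rfloor>}"] card_image[OF inj] by (metis finite_atMost)
  then have "real (card A) \<le> real (nat \<lfloor>x / real l\<rfloor>) + 1"
    by simp
  also have "real (nat \<lfloor>x / real l\<rfloor>) \<le> x / real l"
    using \<open>x \<ge> 0\<close> by (simp add: of_nat_floor)
  finally show ?thesis by simp
qed

text \<open>Counting pairs (q, n) with n \<in> \<open>S q\<close> by n first turns the left side
  into the square of a sum over \<open>U\<close> of multiplicities. Cauchy-Schwarz over
  \<open>U\<close> bounds it, and expanding the squared multiplicities counts the pairwise
  intersections.\<close>

lemma sum_card_squared_le:
  fixes S :: "'a \<Rightarrow> 'b set"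
  assumes "finite Q" "finite U" and sub: "\<And>q. q \<in> Q \<Longrightarrow> S q \<subseteq> U"
  shows "(\<Sum>q\<in>Q. real (card (S q)))\<^sup>2 \<le> (\<Sum>q\<in>Q. \<Sum>r\<in>Q. real (card (S q \<inter> S r))) * real (card U)"
proof -
  define f where "f n q = (of_bool (n \<in> S q) :: real)" for n q
  have card_eq: "real (card T) = (\<Sum>n\<in>U. of_bool (n \<in> T))" if "T \<subseteq> U" for T
    using that \<open>finite U\<close> by (simp add: of_bool_def sum.If_cases Int_absorb1)
  have "(\<Sum>q\<in>Q. real (card (S q))) = (\<Sum>q\<in>Q. \<Sum>n\<in>U. f n q)"
    using sub by (intro sum.cong) (simp_all add: card_eq f_def)
  also have "\<dots> = (\<Sum>n\<in>U. \<Sum>q\<in>Q. f n q)"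
    by (rule sum.swap)
  finally have lhs: "(\<Sum>q\<in>Q. real (card (S q))) = (\<Sum>n\<in>U. \<Sum>q\<in>Q. f n q)" .
  have "(\<Sum>q\<in>Q. \<Sum>r\<in>Q. real (card (S q \<inter> S r))) = (\<Sum>q\<in>Q. \<Sum>r\<in>Q. \<Sum>n\<in>U. f n q * f n r)"
  proof (intro sum.cong refl)
    fix q r assume "q \<in> Q" "r \<in> Q"
    then have "S q \<inter> S r \<subseteq> U" using sub by blast
    then show "real (card (S q \<inter> S r)) = (\<Sum>n\<in>U. f n q * f n r)"
      by (simp only: card_eq f_def Int_iff of_bool_conj)
  qed
  also have "\<dots> = (\<Sum>q\<in>Q. \<Sum>n\<in>U. \<Sum>r\<in>Q. f n q * f n r)"
    by (intro sum.cong refl sum.swap)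
  also have "\<dots> = (\<Sum>n\<in>U. \<Sum>q\<in>Q. \<Sum>r\<in>Q. f n q * f n r)"
    by (rule sum.swap)
  also have "\<dots> = (\<Sum>n\<in>U. (\<Sum>q\<in>Q. f n q)\<^sup>2)"
    by (simp add: power2_eq_square sum_product)
  finally show ?thesis
    using sum_squared_le_sum_of_squares[of "\<lambda>n. \<Sum>q\<in>Q. f n q" U] lhs by simp
qed

text \<open>The multiples of \<open>d\<close> up to \<open>Y\<close> are \<open>d * k\<close> with k
  \<le> Y / d; letting k run up to \<open>Y\<close> only adds nonnegative terms and leaves
  \<open>harm Y\<close> with the factor 1/d.\<close>

lemma sum_inverse_multiples_le:
  assumes "d > 0"
  shows "(\<Sum>q\<in>{q\<in>{1..Y}. d dvd q}. 1 / real q) \<le> harm Y / real d"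
proof -
  have "{q\<in>{1..Y}. d dvd q} \<subseteq> (\<lambda>k. d * k) ` {1..Y}"
  proof
    fix q assume q: "q \<in> {q\<in>{1..Y}. d dvd q}"
    then obtain k where k: "q = d * k" by auto
    with q assms have "k \<ge> 1" "k \<le> d * k" by (auto intro: Suc_leI)
    moreover from q k have "d * k \<le> Y" by simp
    ultimately have "k \<in> {1..Y}"
      using order.trans[of k "d * k" Y] by simp
    then show "q \<in> (\<lambda>k. d * k) ` {1..Y}" using k by blast
  qed
  then have "(\<Sum>q\<in>{q\<in>{1..Y}. d dvd q}. 1 / real q) \<le> (\<Sum>q\<in>(\<lambda>k. d * k) ` {1..Y}. 1 / real q)"
    by (intro sum_mono2) auto
  also have "\<dots> = (\<Sum>k\<in>{1..Y}. 1 / real (d * k))"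
    using assms by (subst sum.reindex) (auto simp: inj_on_def)
  also have "\<dots> = harm Y / real d"
    by (simp add: harm_def sum_divide_distrib field_simps)
  finally show ?thesis .
qed

text \<open>Replacing the gcd by the sum of all common divisors d decouples q from r: each d
  contributes d times the square of a sum over multiples of d, at most
  \<open>(harm Y)\<^sup>2 / d\<close>. Summing over d supplies the third factor.\<close>

lemma sum_gcd_le_harm_cubed:
  "(\<Sum>q\<in>{1..Y}. \<Sum>r\<in>{1..Y}. real (gcd q r) / (real q * real r)) \<le> harm Y ^ 3"
proof -
  \<comment> \<open>The divisibility condition moves into the summand, so that all ranges are fixed
    and the sums can be swapped.\<close>
  define g where "g d q = (if d dvd q then 1 / real q else 0)" for d q
  have "(\<Sum>q\<in>{1..Y}. \<Sum>r\<in>{1..Y}. real (gcd q r) / (real q * real r))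
      \<le> (\<Sum>q\<in>{1..Y}. \<Sum>r\<in>{1..Y}. \<Sum>d\<in>{1..Y}. real d * (g d q * g d r))"
  proof (intro sum_mono)
    fix q r assume q: "q \<in> {1..Y}" and r: "r \<in> {1..Y}"
    have "gcd q r \<in> {1..Y}"
      using q r by (auto simp: Suc_le_eq intro: order.trans[OF gcd_le1_nat])
    \<comment> \<open>The single term d = gcd q r of the nonnegative sum is already the required
      quantity.\<close>
    then have "real (gcd q r) * (g (gcd q r) q * g (gcd q r) r) \<le> (\<Sum>d\<in>{1..Y}. real d * (g d q * g d r))"
      by (intro member_le_sum) (auto simp: g_def)
    then show "real (gcd q r) / (real q * real r) \<le> (\<Sum>d\<in>{1..Y}. real d * (g d q * g d r))"
      by (simp add: g_def)
  qed
  also have "\<dots> = (\<Sum>q\<in>{1..Y}. \<Sum>d\<in>{1..Y}. \<Sum>r\<in>{1..Y}. real d * (g d q * g d r))"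
    by (intro sum.cong refl sum.swap)
  also have "\<dots> = (\<Sum>d\<in>{1..Y}. \<Sum>q\<in>{1..Y}. \<Sum>r\<in>{1..Y}. real d * (g d q * g d r))"
    by (rule sum.swap)
  also have "\<dots> = (\<Sum>d\<in>{1..Y}. real d * (\<Sum>q\<in>{1..Y}. g d q)\<^sup>2)"
    by (subst power2_eq_square, subst sum_product) (simp only: sum_distrib_left)
  also have "\<dots> \<le> (\<Sum>d\<in>{1..Y}. real d * (harm Y / real d)\<^sup>2)"
  proof (intro sum_mono mult_left_mono power_mono)
    fix d assume "d \<in> {1..Y}"
    moreover have "(\<Sum>q\<in>{1..Y}. g d q) = (\<Sum>q\<in>{q\<in>{1..Y}. d dvd q}. 1 / real q)"
      unfolding g_def by (rule sum.inter_filter[symmetric]) simp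
    ultimately show "(\<Sum>q\<in>{1..Y}. g d q) \<le> harm Y / real d"
      using sum_inverse_multiples_le[of d Y] by simp
  qed (auto simp: g_def intro: sum_nonneg)
  also have "\<dots> = (\<Sum>d\<in>{1..Y}. (harm Y)\<^sup>2 * inverse (real d))"
    by (intro sum.cong) (auto simp: power2_eq_square field_simps)
  also have "\<dots> = harm Y ^ 3"
    by (simp add: harm_def flip: sum_distrib_left) (simp add: power2_eq_square power3_eq_cube)
  finally show ?thesis .
qed

lemma harm_le_ln_plus_1:
  assumes "n > 0"
  shows "harm n \<le> ln (real n) + (1 :: real)"
  using euler_mascheroni_sequence_decreasing[of 1 n] assms by (simp add: harm_def)

text \<open>Cauchy-Schwarz is applied to one rich residue class for each modulus. The lower bound
  \<open>M\<close> does not depend on q, so the sum of the class sizes is at least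
  \<open>card Q * M\<close>.\<close>

lemma card_exceptional_moduli_squared_le:
  fixes B Q :: "nat set" and x M :: real
  assumes "x \<ge> 1" "M \<ge> 0"
    and Q: "\<And>q. q \<in> Q \<Longrightarrow> q > 0 \<and> real q \<le> sqrt x"
    and large: "\<And>q. q \<in> Q \<Longrightarrow> \<exists>h. real (count_ap B h q x) \<ge> M"
  shows "(real (card Q) * M)\<^sup>2 \<le> 2 * x * (1 + ln x) ^ 3 * real (count_upto B x)"
proof -
  obtain h where h: "\<And>q. q \<in> Q \<Longrightarrow> real (count_ap B (h q) q x) \<ge> M"
    using large by metis
  define S where "S q = {n \<in> B. real n \<le> x \<and> [int n = h q] (mod int q)}" for q
  define U where "U = {n \<in> B. real n \<le> x}"
  define Y where "Y = nat \<lfloor>sqrt x\<rfloor>"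
  have "sqrt x \<ge> 1" using \<open>x \<ge> 1\<close> by simp
  then have Y: "Y > 0" "real Y \<le> sqrt x"
    by (auto simp: Y_def)
  have QY: "Q \<subseteq> {1..Y}"
    using Q by (auto simp: Y_def Suc_le_eq le_nat_floor)
  then have "finite Q"
    by (rule finite_subset) simp
  have "U \<subseteq> {..nat \<lfloor>x\<rfloor>}"
    by (auto simp: U_def le_nat_floor)
  then have "finite U"
    by (rule finite_subset) simp
  have inter: "real (card (S q \<inter> S r)) \<le> 2 * x * (real (gcd q r) / (real q * real r))"
    if "q \<in> Q" "r \<in> Q" for q r
  proof -
    have pos: "q > 0" "r > 0"
      using Q that by auto
    \<comment> \<open>Two congruences modulo q and modulo r combine to one modulo their lcm, whether
      or not q and r are coprime.\<close>
    have "real (card (S q \<inter> S r)) \<le> x / real (lcm q r) + 1"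
    proof (rule card_residue_class_le)
      fix m n assume "m \<in> S q \<inter> S r" "n \<in> S q \<inter> S r"
      then have "[int m = int n] (mod int q)" "[int m = int n] (mod int r)"
        unfolding S_def by (auto intro: cong_trans cong_sym)
      then show "[m = n] (mod lcm q r)"
        by (intro cong_cong_lcm_nat) (simp_all add: cong_int_iff)
    qed (use pos \<open>x \<ge> 1\<close> in \<open>auto simp: S_def lcm_pos_nat\<close>)
    also have "x / real (lcm q r) = x * (real (gcd q r) / (real q * real r))"
    proof -
      have "real q * real r = real (gcd q r) * real (lcm q r)"
        by (metis of_nat_mult prod_gcd_lcm_nat)
      then show ?thesis using pos by (simp add: field_simps)
    qed
    \<comment> \<open>Here the range q, r \<le> sqrt x is decisive: q r \<le> x lets the main term
      absorb the summand 1, which costs the factor 2.\<close>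
    also have "1 \<le> x * (real (gcd q r) / (real q * real r))"
    proof -
      have "real q * real r \<le> sqrt x * sqrt x"
        using Q that \<open>x \<ge> 1\<close> by (intro mult_mono) auto
      then have "real q * real r \<le> x * 1"
        using \<open>x \<ge> 1\<close> by simp
      also have "\<dots> \<le> x * real (gcd q r)"
        using pos \<open>x \<ge> 1\<close> by (intro mult_left_mono) (auto simp: Suc_le_eq)
      finally show ?thesis
        using pos by (simp add: field_simps)
    qed
    finally show ?thesis by simp
  qed
  have "(real (card Q) * M)\<^sup>2 \<le> (\<Sum>q\<in>Q. real (card (S q)))\<^sup>2"
  proof (rule power_mono)
    have "real (card Q) * M = (\<Sum>q\<in>Q. M)" by simp
    also have "\<dots> \<le> (\<Sum>q\<in>Q. real (card (S q)))"
      using h by (intro sum_mono) (simp add: S_def count_ap_def)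
    finally show "real (card Q) * M \<le> (\<Sum>q\<in>Q. real (card (S q)))" .
  qed (use \<open>M \<ge> 0\<close> in simp)
  also have "\<dots> \<le> (\<Sum>q\<in>Q. \<Sum>r\<in>Q. real (card (S q \<inter> S r))) * real (card U)"
    using \<open>finite Q\<close> \<open>finite U\<close> by (rule sum_card_squared_le) (auto simp: S_def U_def)
  also have "\<dots> \<le> (2 * x * (1 + ln x) ^ 3) * real (card U)"
  proof (rule mult_right_mono)
    let ?t = "\<lambda>q r. 2 * x * (real (gcd q r) / (real q * real r))"
    have "(\<Sum>q\<in>Q. \<Sum>r\<in>Q. real (card (S q \<inter> S r))) \<le> (\<Sum>q\<in>Q. \<Sum>r\<in>Q. ?t q r)"
      using inter by (intro sum_mono)
    \<comment> \<open>Nothing is known about \<open>Q\<close> beyond its range, so the sum is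
      extended to all moduli up to sqrt x; the terms are nonnegative.\<close>
    also have "\<dots> \<le> (\<Sum>q\<in>{1..Y}. \<Sum>r\<in>{1..Y}. ?t q r)"
      using QY \<open>x \<ge> 1\<close>
      by (intro order.trans[OF sum_mono sum_mono2] sum_mono2) (auto intro!: sum_nonneg)
    also have "\<dots> = 2 * x * (\<Sum>q\<in>{1..Y}. \<Sum>r\<in>{1..Y}. real (gcd q r) / (real q * real r))"
      by (simp only: sum_distrib_left)
    also have "\<dots> \<le> 2 * x * harm Y ^ 3"
      using \<open>x \<ge> 1\<close> by (intro mult_left_mono sum_gcd_le_harm_cubed) simp
    also have "\<dots> \<le> 2 * x * (1 + ln x) ^ 3"
    proof (intro mult_left_mono power_mono)
      have "sqrt x \<le> x"
        using \<open>x \<ge> 1\<close> by (simp add: real_sqrt_le_iff real_le_lsqrt power2_eq_square)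
      then have "ln (real Y) \<le> ln x"
        using Y by (intro ln_mono) auto
      then show "harm Y \<le> 1 + ln x"
        using harm_le_ln_plus_1[OF Y(1)] by simp
    qed (use \<open>x \<ge> 1\<close> in \<open>auto simp: harm_nonneg\<close>)
    finally show "(\<Sum>q\<in>Q. \<Sum>r\<in>Q. real (card (S q \<inter> S r))) \<le> 2 * x * (1 + ln x) ^ 3" .
  qed simp
  finally show ?thesis
    by (simp add: U_def count_upto_def)
qed

theorem lemma1:
  fixes B :: "nat set"
  assumes B_pos: "B \<subseteq> {1..}"
    and B_sparse: "\<And>A::real. A > 0 \<Longrightarrow>
      \<exists>K::real. \<forall>x::real. x \<ge> 2 \<longrightarrow> real (count_upto B x) \<le> K * (x / ln x powr A)"
  shows "\<forall>C::real. C > 0 \<longrightarrow> (\<exists>K::real. K > 0 \<and>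
    (\<lambda>x::real. real (card {q::nat. q > 0 \<and> real q \<le> x powr (1/2) \<and>
        (\<exists>h::int. real (count_ap B h q x) > K * (x / (real q * ln x powr C)))}))
      \<in> o[at_top](\<lambda>x. x powr (1/2)))"
proof (intro allI impI)
  fix C :: real assume "C > 0"
  \<comment> \<open>The factor 1 is the witness for the constant of the conclusion.\<close>
  define N where "N x = card {q::nat. q > 0 \<and> real q \<le> x powr (1/2) \<and>
        (\<exists>h::int. real (count_ap B h q x) > 1 * (x / (real q * ln x powr C)))}" for x
  \<comment> \<open>Of the exponent, 2C cancels the square of the threshold's log power and 3 pays
    for the gcd sum. The remaining 2 becomes a saving of one factor \<open>ln x\<close> after the
    square root.\<close>
  obtain K where K: "\<And>x. x \<ge> 2 \<Longrightarrow> real (count_upto B x) \<le> K * (x / ln x powr (2 * C + 5))"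
    using B_sparse[of "2 * C + 5"] \<open>C > 0\<close> by auto
  have "real (N x) \<le> sqrt (16 * K) * (sqrt x / ln x)" if "x \<ge> exp 1" for x
  proof -
    have x: "x \<ge> 2"
      using that exp_ge_add_one_self[of 1] by linarith
    have L: "ln x \<ge> 1"
      using that x by (simp add: ln_ge_iff)
    define P where "P = ln x powr C"
    have P: "P > 0"
      using L by (simp add: P_def)
    have P2: "ln x powr (2 * C + 5) = P\<^sup>2 * ln x ^ 5"
      using L by (simp add: P_def powr_add powr_powr mult.commute flip: powr_numeral)
    have "(real (N x) * (sqrt x / P))\<^sup>2 \<le> 2 * x * (1 + ln x) ^ 3 * real (count_upto B x)"
      unfolding N_def
    proof (rule card_exceptional_moduli_squared_le)
      fix q assume "q \<in> {q::nat. q > 0 \<and> real q \<le> x powr (1/2) \<and>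
        (\<exists>h::int. real (count_ap B h q x) > 1 * (x / (real q * ln x powr C)))}"
      then obtain h where q: "q > 0" "real q \<le> sqrt x" and h: "real (count_ap B h q x) > x / (real q * P)"
        using x by (auto simp: powr_half_sqrt P_def)
      show "0 < q \<and> real q \<le> sqrt x" using q by simp
      \<comment> \<open>As q \<le> sqrt x, the threshold x / (q P) is at least sqrt x / P, which
        serves as the bound \<open>M\<close> common to all moduli.\<close>
      have "sqrt x * real q \<le> x"
        using mult_left_mono[OF q(2), of "sqrt x"] x by simp
      then have "sqrt x / P \<le> x / (real q * P)"
        using q P by (simp add: field_simps)
      then show "\<exists>h. sqrt x / P \<le> real (count_ap B h q x)"
        using h by (intro exI[of _ h]) simp
    qed (use x P in auto)
    \<comment> \<open>Since ln x \<ge> 1, 1 + ln x \<le> 2 ln x; the constant 16 below is 2 times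
      the cube of 2.\<close>
    also have "\<dots> \<le> 2 * x * (2 * ln x) ^ 3 * (K * (x / (P\<^sup>2 * ln x ^ 5)))"
      using K[OF x] L x unfolding P2 by (intro mult_mono power_mono) auto
    also have "\<dots> = 16 * K * (x / ln x ^ 2) * (x / P\<^sup>2)"
      using L P by (simp add: field_simps eval_nat_numeral)
    finally have "(real (N x))\<^sup>2 * (x / P\<^sup>2) \<le> 16 * K * (x / ln x ^ 2) * (x / P\<^sup>2)"
      using x by (simp add: power_mult_distrib power_divide)
    then have "(real (N x))\<^sup>2 \<le> 16 * K * (x / ln x ^ 2)"
      using x P by (subst (asm) mult_le_cancel_right_pos) auto
    then have "real (N x) \<le> sqrt (16 * K * (x / ln x ^ 2))"
      by (rule real_le_rsqrt)
    also have "\<dots> = sqrt (16 * K) * (sqrt x / ln x)"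
      using L by (simp add: real_sqrt_mult real_sqrt_divide)
    finally show ?thesis .
  qed
  moreover have "sqrt x / ln x \<ge> 0" if "x \<ge> exp 1" for x :: real
    using that exp_ge_add_one_self[of 1] by simp
  ultimately have "eventually (\<lambda>x. norm (real (N x)) \<le> sqrt (16 * K) * norm (sqrt x / ln x)) at_top"
    by (intro eventually_at_top_linorderI[of "exp 1"]) (simp only: real_norm_def abs_of_nonneg of_nat_0_le_iff)
  then have "(\<lambda>x. real (N x)) \<in> O(\<lambda>x. sqrt x / ln x)"
    by (rule bigoI)
  also have "(\<lambda>x::real. sqrt x / ln x) \<in> o(\<lambda>x. x powr (1/2))"
    by real_asymp
  finally show "\<exists>K::real. K > 0 \<and>
    (\<lambda>x::real. real (card {q::nat. q > 0 \<and> real q \<le> x powr (1/2) \<and>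
        (\<exists>h::int. real (count_ap B h q x) > K * (x / (real q * ln x powr C)))}))
      \<in> o[at_top](\<lambda>x. x powr (1/2))"
    unfolding N_def by (intro exI[of _ 1]) simp
qed

end
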